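(* Let $n,g,h\in\mathbb{Z}^+$ and let $\Gamma\subseteq M_n(\mathbb{C})^g$ be nonempty, open and similarity invariant. If $\beta:\Gamma\to M_n(\mathbb{C})^h$ is analytic and respects conjugation by unitaries, i.e. $\beta(U^{-1}XU)=U^{-1}\beta(X)U$ for all $X\in\Gamma$ and all $n\times n$ unitary matrices $U$, then $\beta$ respects conjugation by similarities, i.e. $\beta(S^{-1}XS)=S^{-1}\beta(X)S$ for all $X\in\Gamma$ and all $S\in\mathrm{GL}_n(\mathbb{C})$.
   Context: $M_n(\mathbb{C})^g$ is the space of $g$-tuples of $n\times n$ complex matrices. For $X=(X_1,\dots,X_g)$ and $S\in\mathrm{GL}_n(\mathbb{C})$, $S^{-1}XS=(S^{-1}X_1S,\dots,S^{-1}X_gS)$. The set $\Gamma$ is similarity invariant if $S^{-1}XS\in\Gamma$ for all $X\in\Gamma$ and $S\in\mathrm{GL}_n(\mathbb{C})$. Analytic means complex analytic (holomorphic). *)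

theory Defs
  imports "HOL-Analysis.Analysis"
begin

text \<open>
  A g-tuple of complex n-by-n matrices is an element of \<open>complex^'n^'n^'g\<close>, where
  \<open>n = CARD('n)\<close> and \<open>g = CARD('g)\<close>; its k-th matrix is \<open>X $ k\<close>. The norm topology of
  this type is the usual one on the space of tuples.
\<close>

definition tuple_scale :: "complex \<Rightarrow> complex^'n^'n^'g \<Rightarrow> complex^'n^'n^'g" where
  "tuple_scale c X = (\<chi> k. map_matrix ((*) c) (X $ k))"

text \<open>
  Holomorphy in several variables: complex Frechet differentiability at every point. The
  library's \<open>has_derivative\<close> only asks for a real-linear derivative (these types carry no
  complex vector space structure), so complex homogeneity of the derivative is added.
  Intended for open domains, as with the library's \<open>holomorphic_on\<close>.
\<close>

definition tuple_holomorphic_on ::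
    "(complex^'n^'n^'g \<Rightarrow> complex^'m^'m^'h) \<Rightarrow> (complex^'n^'n^'g) set \<Rightarrow> bool" where
  "tuple_holomorphic_on f A \<longleftrightarrow>
     (\<forall>X\<in>A. \<exists>D. (f has_derivative D) (at X within A) \<and>
        (\<forall>c V. D (tuple_scale c V) = tuple_scale c (D V)))"

definition tuple_conj :: "complex^'n^'n \<Rightarrow> complex^'n^'n^'g \<Rightarrow> complex^'n^'n^'g" where
  "tuple_conj S X = (\<chi> k. matrix_inv S ** (X $ k) ** S)"

definition similarity_invariant :: "(complex^'n^'n^'g) set \<Rightarrow> bool" where
  "similarity_invariant A \<longleftrightarrow> (\<forall>X\<in>A. \<forall>S. invertible S \<longrightarrow> tuple_conj S X \<in> A)"

definition conj_transpose :: "complex^'n^'m \<Rightarrow> complex^'m^'n" where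
  "conj_transpose U = map_matrix cnj (transpose U)"

definition unitary_matrix :: "complex^'n^'n \<Rightarrow> bool" where
  "unitary_matrix U \<longleftrightarrow> conj_transpose U ** U = mat 1 \<and> U ** conj_transpose U = mat 1"

end

theory Submission
  imports Defs "HOL-Complex_Analysis.Conformal_Mappings"
begin

text \<open>
  The invertible \<open>S\<close> with \<open>\<beta> (S\<^sup>-\<^sup>1XS) = S\<^sup>-\<^sup>1\<beta>(X)S\<close> on \<open>\<Gamma>\<close> are closed under products and
  contain the unitaries, so it is enough to find generators of \<open>GL\<^sub>n\<close> among them. For real
  \<open>x\<^sub>i\<close> and \<open>S\<^sub>z = diag (exp (z x\<^sub>i))\<close>, the function \<open>z \<mapsto> S\<^sub>z \<beta>(S\<^sub>z\<^sup>-\<^sup>1XS\<^sub>z) S\<^sub>z\<^sup>-\<^sup>1\<close> is entire, and it is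
  constant on the imaginary axis because \<open>S\<^sub>z\<close> is unitary there; hence it is constant. Together
  with the diagonal unitaries this yields all invertible diagonal matrices, and a transvection
  is a product of diagonal matrices and rotations (its singular value decomposition).
\<close>

section \<open>Inverses of matrices and conjugation of tuples\<close>

definition respects_conj ::
    "(complex^'n^'n^'g \<Rightarrow> complex^'n^'n^'h) \<Rightarrow> (complex^'n^'n^'g) set \<Rightarrow> complex^'n^'n \<Rightarrow> bool" where
  "respects_conj \<beta> A S \<longleftrightarrow> (\<forall>X\<in>A. \<beta> (tuple_conj S X) = tuple_conj S (\<beta> X))"

text \<open>Over a field a right inverse of a square matrix is two-sided, and two-sided inverses are
  unique, so the choice in \<open>matrix_inv\<close> is forced.\<close>

lemma matrix_inv_unique:
  fixes A B :: "'a::field^'n^'n"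
  assumes "A ** B = mat 1"
  shows "matrix_inv A = B"
  unfolding matrix_inv_def
proof (rule some_equality)
  have BA: "B ** A = mat 1"
    using assms by (rule iffD1[OF matrix_left_right_inverse])
  then show "A ** B = mat 1 \<and> B ** A = mat 1"
    using assms by (rule conjI[rotated])
  fix C
  assume C: "A ** C = mat 1 \<and> C ** A = mat 1"
  have "C = B ** A ** C"
    unfolding BA by (rule matrix_mul_lid[symmetric])
  also have "\<dots> = B ** (A ** C)"
    by (rule matrix_mul_assoc[symmetric])
  also have "\<dots> = B"
    unfolding conjunct1[OF C] by (rule matrix_mul_rid)
  finally show "C = B" .
qed

lemma matrix_inv_matrix_mul:
  fixes A B :: "'a::field^'n^'n"
  assumes "invertible A" "invertible B"
  shows "matrix_inv (A ** B) = matrix_inv B ** matrix_inv A"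
proof -
  obtain A' B' where A': "A ** A' = mat 1" and B': "B ** B' = mat 1"
    using assms unfolding invertible_def by blast
  have "A ** B ** (B' ** A') = A ** (B ** B') ** A'"
    by (simp only: matrix_mul_assoc)
  also have "\<dots> = mat 1"
    unfolding B' matrix_mul_rid by (rule A')
  finally have "matrix_inv (A ** B) = B' ** A'"
    by (rule matrix_inv_unique)
  then show ?thesis
    unfolding matrix_inv_unique[OF A'] matrix_inv_unique[OF B'] .
qed

lemma tuple_conj_matrix_mul:
  assumes "invertible A" "invertible B"
  shows "tuple_conj (A ** B) X = tuple_conj B (tuple_conj A X)"
  using assms by (simp add: tuple_conj_def matrix_inv_matrix_mul matrix_mul_assoc)

text \<open>Conjugation is a right action: \<open>X\<close> is conjugated by \<open>A\<close> first,
  and similarity invariance keeps the result in \<Gamma>, where the assumption on \<open>B\<close>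
  applies.\<close>

lemma respects_conj_matrix_mul:
  assumes "similarity_invariant \<Gamma>" "invertible A" "invertible B"
    and "respects_conj \<beta> \<Gamma> A" "respects_conj \<beta> \<Gamma> B"
  shows "respects_conj \<beta> \<Gamma> (A ** B)"
  using assms by (simp add: respects_conj_def similarity_invariant_def tuple_conj_matrix_mul)

lemma unitary_matrix_invertible: "unitary_matrix U \<Longrightarrow> invertible U"
  by (auto simp: unitary_matrix_def invertible_def)

section \<open>Diagonal matrices\<close>

definition diag_matrix :: "('n \<Rightarrow> 'a::zero) \<Rightarrow> 'a^'n^'n" where
  "diag_matrix d = (\<chi> i j. if i = j then d i else 0)"

lemma diag_matrix_mul:
  fixes d e :: "'n::finite \<Rightarrow> 'a::semiring_1"
  shows "diag_matrix d ** diag_matrix e = diag_matrix (\<lambda>i. d i * e i)"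
  by (simp add: diag_matrix_def matrix_matrix_mult_def vec_eq_iff if_distrib [where f = "\<lambda>x. x * _"]
      cong: if_cong)

lemma diag_matrix_one: "diag_matrix (\<lambda>_. 1) = mat 1"
  by (simp add: diag_matrix_def mat_def)

lemma diag_matrix_inverse:
  fixes d :: "'n::finite \<Rightarrow> 'a::field"
  assumes "\<And>i. d i \<noteq> 0"
  shows "diag_matrix d ** diag_matrix (\<lambda>i. inverse (d i)) = mat 1"
  using assms by (simp add: diag_matrix_mul diag_matrix_one)

lemma invertible_diag_matrix:
  fixes d :: "'n::finite \<Rightarrow> 'a::field"
  assumes "\<And>i. d i \<noteq> 0"
  shows "invertible (diag_matrix d)"
  using diag_matrix_inverse[of d] assms by (auto simp: invertible_right_inverse)

lemma tuple_conj_diag_matrix: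
  assumes "\<And>i. d i \<noteq> 0"
  shows "tuple_conj (diag_matrix d) X $ k $ i $ j = inverse (d i) * X $ k $ i $ j * d j"
proof -
  have "matrix_inv (diag_matrix d) = diag_matrix (\<lambda>i. inverse (d i))"
    using assms by (intro matrix_inv_unique diag_matrix_inverse)
  then show ?thesis
    by (simp add: tuple_conj_def diag_matrix_def matrix_matrix_mult_def
        if_distrib [where f = "\<lambda>x. x * _"] if_distrib [where f = "\<lambda>x. _ * x"] cong: if_cong)
qed

lemma conj_transpose_diag_matrix:
  "conj_transpose (diag_matrix d) = diag_matrix (\<lambda>i. cnj (d i))"
  by (auto simp: conj_transpose_def diag_matrix_def map_matrix_def transpose_def vec_eq_iff)

lemma unitary_diag_matrix:
  assumes "\<And>i. norm (d i) = 1"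
  shows "unitary_matrix (diag_matrix d)"
proof -
  have "d i * cnj (d i) = 1" for i
    using assms[of i] by (simp add: complex_norm_square[symmetric])
  then show ?thesis
    by (simp add: unitary_matrix_def conj_transpose_diag_matrix diag_matrix_mul diag_matrix_one
        mult.commute)
qed

lemma tuple_conj_exp_diag:
  "tuple_conj (diag_matrix (\<lambda>i. exp (z * x i))) X $ k $ i $ j = X $ k $ i $ j * exp (z * (x j - x i))"
  by (simp add: tuple_conj_diag_matrix right_diff_distrib exp_diff field_simps)

section \<open>Holomorphic functions along a complex curve of tuples\<close>

lemma has_derivative_vec:
  fixes f :: "'a::real_normed_vector \<Rightarrow> 'b::euclidean_space^'n"
  assumes "\<And>i. ((\<lambda>x. f x $ i) has_derivative (\<lambda>h. f' h $ i)) (at x within S)"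
  shows "(f has_derivative f') (at x within S)"
  using assms
  by (subst has_derivative_componentwise_within)
    (auto simp: Basis_vec_def inner_axis intro!: has_derivative_inner_left)

lemma has_derivative_tuple:
  fixes f :: "complex \<Rightarrow> complex^'n^'n^'g"
  assumes "\<And>k i j. ((\<lambda>z. f z $ k $ i $ j) has_field_derivative D $ k $ i $ j) (at z)"
  shows "(f has_derivative (\<lambda>c. tuple_scale c D)) (at z)"
  using assms
  by (intro has_derivative_vec)
    (simp add: tuple_scale_def has_field_derivative_def mult_commute_abs)

text \<open>By the chain rule the derivative of the composition sends \<open>c\<close> to
  \<open>E (tuple_scale c (D z))\<close>. Complex homogeneity of \<open>E\<close> turns this into
  \<open>c\<close> times a fixed tuple, so each entry has a complex derivative.\<close>

lemma holomorphic_on_tuple_compose: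
  fixes \<beta> :: "complex^'n^'n^'g \<Rightarrow> complex^'m^'m^'h" and f D :: "complex \<Rightarrow> complex^'n^'n^'g"
  assumes "tuple_holomorphic_on \<beta> \<Gamma>" "open \<Gamma>"
    and der: "\<And>z k i j. ((\<lambda>z. f z $ k $ i $ j) has_field_derivative D z $ k $ i $ j) (at z)"
    and "\<And>z. f z \<in> \<Gamma>"
  shows "(\<lambda>z. \<beta> (f z) $ k $ i $ j) holomorphic_on UNIV"
proof -
  have "\<exists>f'. ((\<lambda>z. \<beta> (f z) $ k $ i $ j) has_field_derivative f') (at z)" for z
  proof -
    obtain E where E: "(\<beta> has_derivative E) (at (f z))"
      and scale: "\<And>c V. E (tuple_scale c V) = tuple_scale c (E V)"
      using assms at_within_open[of "f z" \<Gamma>] unfolding tuple_holomorphic_on_def by metis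
    have "((\<lambda>z. \<beta> (f z)) has_derivative (\<lambda>c. E (tuple_scale c (D z)))) (at z)"
      using has_derivative_compose[OF has_derivative_tuple[OF der] E] .
    then have "((\<lambda>z. \<beta> (f z) $ k $ i $ j) has_derivative
        (\<lambda>c. tuple_scale c (E (D z)) $ k $ i $ j)) (at z)"
      unfolding scale
      by (intro bounded_linear.has_derivative[OF bounded_linear_vec_nth])
    then have "((\<lambda>z. \<beta> (f z) $ k $ i $ j) has_field_derivative E (D z) $ k $ i $ j) (at z)"
      by (simp add: has_field_derivative_def tuple_scale_def map_matrix_def mult_commute_abs)
    then show ?thesis ..
  qed
  then show ?thesis
    by (simp add: holomorphic_on_open)
qed

text \<open>The imaginary axis accumulates at 0, so the identity theorem applies to the difference
  of \<open>f\<close> and the constant \<open>f 0\<close>.\<close>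

lemma holomorphic_constant_if_constant_on_imaginary:
  assumes "f holomorphic_on UNIV" and "\<And>t. f (\<i> * of_real t) = f 0"
  shows "f z = f 0"
proof -
  have "\<exists>w\<in>range (\<lambda>t. \<i> * of_real t). w \<noteq> 0 \<and> dist w 0 < e" if "e > 0" for e
    using that by (intro bexI[of _ "\<i> * of_real (e / 2)"] rangeI) (auto simp: norm_mult)
  then have "0 islimpt range (\<lambda>t. \<i> * of_real t)"
    by (auto simp: islimpt_approachable)
  moreover have "(\<lambda>z. f z - f 0) holomorphic_on UNIV"
    using assms(1) by (intro holomorphic_intros)
  ultimately have "f z - f 0 = 0"
    using assms(2) analytic_continuation[of "\<lambda>z. f z - f 0" UNIV "range (\<lambda>t. \<i> * of_real t)" 0 z]
    by fastforce
  then show ?thesis by simp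
qed

section \<open>Matrices acting in two coordinates: rotations and transvections\<close>

text \<open>The identity matrix with the entries at \<open>{p, q} \<times> {p, q}\<close> replaced by \<open>a b; c d\<close>.\<close>

definition block_matrix :: "'n \<Rightarrow> 'n \<Rightarrow> 'a \<Rightarrow> 'a \<Rightarrow> 'a \<Rightarrow> 'a \<Rightarrow> 'a::zero_neq_one^'n^'n" where
  "block_matrix p q a b c d = (\<chi> i j.
     if i = p then (if j = p then a else if j = q then b else 0)
     else if i = q then (if j = p then c else if j = q then d else 0)
     else of_bool (i = j))"

lemma block_matrix_mul:
  fixes a b c d :: "'a::comm_ring_1" and p q :: "'n::finite"
  assumes "p \<noteq> q"
  shows "block_matrix p q a b c d ** block_matrix p q a' b' c' d' =
    block_matrix p q (a * a' + b * c') (a * b' + b * d') (c * a' + d * c') (c * b' + d * d')"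
    (is "?A ** ?B = ?C")
proof -
  have "(\<Sum>k\<in>UNIV. ?A $ i $ k * ?B $ k $ j) = ?C $ i $ j" for i j
  proof (cases "i = p \<or> i = q")
    case True
    then have "(\<Sum>k\<in>UNIV. ?A $ i $ k * ?B $ k $ j) = (\<Sum>k\<in>{p, q}. ?A $ i $ k * ?B $ k $ j)"
      by (intro sum.mono_neutral_right) (auto simp: block_matrix_def)
    then show ?thesis
      using True assms by (auto simp: block_matrix_def)
  next
    case False
    then have "(\<Sum>k\<in>UNIV. ?A $ i $ k * ?B $ k $ j) = (\<Sum>k\<in>{i}. ?A $ i $ k * ?B $ k $ j)"
      by (intro sum.mono_neutral_right) (auto simp: block_matrix_def)
    then show ?thesis
      using False by (auto simp: block_matrix_def)
  qed
  then show ?thesis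
    by (simp add: matrix_matrix_mult_def vec_eq_iff)
qed

lemma block_matrix_one: "p \<noteq> q \<Longrightarrow> block_matrix p q 1 0 0 1 = mat 1"
  by (auto simp: block_matrix_def mat_def vec_eq_iff)

lemma conj_transpose_block_matrix:
  "p \<noteq> q \<Longrightarrow> conj_transpose (block_matrix p q a b c d) =
     block_matrix p q (cnj a) (cnj c) (cnj b) (cnj d)"
  by (auto simp: conj_transpose_def block_matrix_def map_matrix_def transpose_def vec_eq_iff)

lemma block_matrix_diagonal:
  "p \<noteq> q \<Longrightarrow> block_matrix p q a 0 0 d = diag_matrix (\<lambda>i. if i = p then a else if i = q then d else 1)"
  by (auto simp: block_matrix_def diag_matrix_def vec_eq_iff)

lemma unitary_rotation:
  fixes a b :: real
  assumes "p \<noteq> q" "a\<^sup>2 + b\<^sup>2 = 1"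
  shows "unitary_matrix (block_matrix p q (of_real a) (of_real (- b)) (of_real b) (of_real a))"
proof -
  have "complex_of_real a * of_real a + of_real b * of_real b = 1"
    using assms(2) by (metis of_real_1 of_real_add of_real_mult power2_eq_square)
  then show ?thesis
    using assms(1)
    by (simp add: unitary_matrix_def conj_transpose_block_matrix block_matrix_mul add.commute
        flip: block_matrix_one)
qed

lemma transvection_mul:
  fixes c :: "'a::comm_ring_1" and p q :: "'n::finite"
  assumes "p \<noteq> q"
  shows "(block_matrix p q 1 c 0 1 ** A) $ i $ j = A $ i $ j + (if i = p then c * A $ q $ j else 0)"
proof -
  have "block_matrix p q 1 c 0 1 $ i $ k =
      (if i = k then 1 else 0) + (if q = k then if i = p then c else 0 else 0)" for k
    using assms by (auto simp: block_matrix_def)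
  then show ?thesis
    by (simp add: matrix_matrix_mult_def distrib_right sum.distrib if_distrib [where f = "\<lambda>x. x * _"]
        cong: if_cong)
qed

section \<open>Generation of the general linear group by diagonal matrices and transvections\<close>

lemma invertible_matrix_mul_iff:
  fixes A B :: "'a::field^'n^'n"
  shows "invertible (A ** B) \<longleftrightarrow> invertible A \<and> invertible B"
  by (simp add: invertible_det_nz det_mul)

lemma invertible_transvection:
  fixes c :: "'a::field"
  assumes "p \<noteq> q"
  shows "invertible (block_matrix p q 1 c 0 1)"
proof -
  have "block_matrix p q 1 c 0 1 ** block_matrix p q 1 (- c) 0 1 = mat 1"
    using assms by (simp add: block_matrix_mul block_matrix_one)
  then show ?thesis
    by (auto simp: invertible_right_inverse)
qed

definition replace_column :: "'n \<Rightarrow> ('n \<Rightarrow> 'a) \<Rightarrow> 'a::zero_neq_one^'n^'n" where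
  "replace_column k v = (\<chi> i j. if j = k then v i else of_bool (i = j))"

lemma replace_column_mul:
  fixes v :: "'n::finite \<Rightarrow> 'a::comm_ring_1"
  shows "(replace_column k v ** A) $ i $ j = v i * A $ k $ j + (if i = k then 0 else A $ i $ j)"
proof -
  have "replace_column k v $ i $ l = (if k = l then v i else 0) + (if i = l then if i = k then 0 else 1 else 0)"
    for l
    by (auto simp: replace_column_def)
  then show ?thesis
    by (simp add: matrix_matrix_mult_def distrib_right sum.distrib if_distrib [where f = "\<lambda>x. x * _"]
        cong: if_cong)
qed

text \<open>Row \<open>k\<close> of \<open>replace_column k v\<close> vanishes outside column
  \<open>k\<close>, so adding a multiple of it to row \<open>p\<close> disturbs no other
  column.\<close>

lemma transvection_mul_replace_column:
  fixes c :: "'a::comm_ring_1"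
  assumes "p \<noteq> k"
  shows "block_matrix p k 1 c 0 1 ** replace_column k v = replace_column k (v(p := v p + c * v k))"
  using assms by (simp add: vec_eq_iff transvection_mul) (auto simp: replace_column_def)

text \<open>Gaussian elimination, clearing one column at a time.\<close>

lemma invertible_matrix_induct [consumes 1, case_names mult diagonal transvection]:
  fixes A :: "'a::field^'n^'n"
  assumes "invertible A"
    and mult: "\<And>A B. invertible A \<Longrightarrow> invertible B \<Longrightarrow> P A \<Longrightarrow> P B \<Longrightarrow> P (A ** B)"
    and diagonal: "\<And>d. (\<And>i. d i \<noteq> 0) \<Longrightarrow> P (diag_matrix d)"
    and transvection: "\<And>p q c. p \<noteq> q \<Longrightarrow> P (block_matrix p q 1 c 0 1)"
  shows "P A"
proof -
  \<comment> \<open>\<open>F\<close> holds the rows off the pivot where \<open>v\<close> may be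
    nonzero. Each induction step splits off a transvection that clears one of them, until a diagonal
    matrix remains.\<close>
  have column: "P (replace_column k v) \<and> invertible (replace_column k v)"
    if "finite F" "k \<notin> F" "v k \<noteq> 0" "\<And>i. i \<noteq> k \<Longrightarrow> i \<notin> F \<Longrightarrow> v i = 0" for k v F
    using that
  proof (induction F arbitrary: v)
    case empty
    then have "replace_column k v = diag_matrix (\<lambda>i. if i = k then v k else 1)"
      by (auto simp: replace_column_def diag_matrix_def vec_eq_iff)
    then show ?case
      using empty by (auto intro!: diagonal invertible_diag_matrix split: if_splits)
  next
    case (insert p F)
    have pk: "p \<noteq> k" using insert by auto
    have "P (replace_column k (v(p := 0))) \<and> invertible (replace_column k (v(p := 0)))"
      using insert by (intro insert.IH) auto
    moreover have "replace_column k v =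
        block_matrix p k 1 (v p / v k) 0 1 ** replace_column k (v(p := 0))"
      using pk insert by (simp add: transvection_mul_replace_column)
    ultimately show ?case
      using pk by (auto intro!: mult transvection invertible_mult invertible_transvection)
  qed
  \<comment> \<open>Induction on the set \<open>K\<close> of columns that may still differ from
    those of the identity.\<close>
  have "P A" if "finite K" "invertible A" "\<And>i j. j \<notin> K \<Longrightarrow> A $ i $ j = of_bool (i = j)" for A K
    using that
  proof (induction K arbitrary: A)
    case empty
    then have "A = diag_matrix (\<lambda>_. 1)"
      by (auto simp: diag_matrix_def vec_eq_iff)
    then show ?case
      by (auto intro!: diagonal)
  next
    case (insert k K)
    \<comment> \<open>With a nonzero pivot, \<open>A\<close> factors as \<open>C ** B\<close>, where
      \<open>C\<close> carries column \<open>k\<close> of \<open>A\<close> and column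
      \<open>k\<close> of \<open>B\<close> is a unit vector. The unit columns of \<open>A\<close>
      outside \<open>insert k K\<close> have a zero in row \<open>k\<close>, so they survive in
      \<open>B\<close>.\<close>
    have pivot: "P A" if A: "A $ k $ k \<noteq> 0" "invertible A"
      "\<And>i j. j \<notin> insert k K \<Longrightarrow> A $ i $ j = of_bool (i = j)" for A
    proof -
      define C where "C = replace_column k (\<lambda>i. A $ i $ k)"
      define B where "B = (\<chi> i j. if i = k then A $ k $ j / A $ k $ k
        else A $ i $ j - A $ i $ k * A $ k $ j / A $ k $ k)"
      have CB: "A = C ** B"
        using A(1) by (simp add: vec_eq_iff C_def replace_column_mul) (simp add: B_def)
      have C: "P C" "invertible C"
        using column[of "UNIV - {k}" k "\<lambda>i. A $ i $ k"] A(1) by (auto simp: C_def)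
      have "invertible B"
        using A(2) CB by (simp add: invertible_matrix_mul_iff)
      moreover have "B $ i $ j = of_bool (i = j)" if "j \<notin> K" for i j
        using that A(1) A(3)[of j] by (cases "j = k") (auto simp: B_def)
      ultimately have "P B"
        by (intro insert.IH)
      then show "P A"
        using C CB \<open>invertible B\<close> mult by simp
    qed
    show ?case
    proof (cases "A $ k $ k = 0")
      case False
      then show ?thesis
        using insert.prems by (intro pivot) auto
    next
      case True
      have "\<exists>l\<in>K. A $ l $ k \<noteq> 0"
      proof (rule ccontr)
        assume "\<not> ?thesis"
        then have 0: "A $ i $ k = 0" if "i \<in> insert k K" for i
          using True that by auto
        \<comment> \<open>If column \<open>k\<close> vanished on all rows in
          \<open>insert k K\<close>, it would be a combination of the unit columns outside that set.
          The vector \<open>x\<close> records this dependence and lies in the kernel of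
          \<open>A\<close>.\<close>
        define x where "x = (\<chi> j. of_bool (j = k) - A $ j $ k)"
        have "A $ i $ j * x $ j = (if k = j then A $ i $ k else 0) - (if i = j then A $ i $ k else 0)"
          for i j
          using 0[of j] insert.prems(2)[of j i] True
          by (cases "j \<in> insert k K"; cases "j = k"; cases "i = j") (simp_all add: x_def)
        then have "A *v x = 0"
          by (simp add: matrix_vector_mult_def vec_eq_iff sum_subtractf)
        moreover have "x $ k = 1"
          using True by (simp add: x_def)
        ultimately show False
          using insert.prems(1) by (metis invertible_left_inverse matrix_left_invertible_ker
              zero_index zero_neq_one)
      qed
      then obtain l where l: "l \<in> K" "A $ l $ k \<noteq> 0" by auto
      then have kl: "k \<noteq> l" using insert.hyps by auto
      \<comment> \<open>Adding row \<open>l\<close> to row \<open>k\<close> makes the pivot equal to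
        \<open>A $ l $ k\<close>. Since \<open>l\<close> is in \<open>K\<close>, the columns outside
        \<open>insert k K\<close> have a zero in row \<open>l\<close> and stay unchanged.\<close>
      let ?B = "block_matrix k l 1 1 0 1 ** A"
      have inv: "invertible ?B"
        using insert.prems(1) kl by (simp add: invertible_matrix_mul_iff invertible_transvection)
      have "P ?B"
        using l kl insert.prems True by (intro pivot inv) (auto simp: transvection_mul)
      moreover have "A = block_matrix k l 1 (- 1) 0 1 ** ?B"
        using kl by (simp add: matrix_mul_assoc block_matrix_mul block_matrix_one)
      ultimately show ?thesis
        using mult[OF invertible_transvection inv transvection, of k l "- 1"] kl by simp
    qed
  qed
  from this[of UNIV A] assms(1) show ?thesis by simp
qed

section \<open>Conjugation by the generators\<close>

context
  fixes \<Gamma> :: "(complex^'n^'n^'g) set"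
    and \<beta> :: "complex^'n^'n^'g \<Rightarrow> complex^'n^'n^'h"
  assumes open_dom: "open \<Gamma>"
    and inv: "similarity_invariant \<Gamma>"
    and holo: "tuple_holomorphic_on \<beta> \<Gamma>"
    and unitary: "\<And>U. unitary_matrix U \<Longrightarrow> respects_conj \<beta> \<Gamma> U"
begin

lemma respects_conj_exp_diag:
  "respects_conj \<beta> \<Gamma> (diag_matrix (\<lambda>i. exp (z * of_real (x i))))"
  unfolding respects_conj_def
proof
  fix X assume X: "X \<in> \<Gamma>"
  define S where "S z = diag_matrix (\<lambda>i. exp (z * complex_of_real (x i)))" for z
  define e where "e z i j = exp (z * (complex_of_real (x j) - complex_of_real (x i)))" for z i j
  have conj_S: "tuple_conj (S z) Y $ k $ i $ j = Y $ k $ i $ j * e z i j"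
    for z k i j and Y :: "complex^'n^'n^'m"
    unfolding S_def e_def by (rule tuple_conj_exp_diag)
  define D :: "complex \<Rightarrow> complex^'n^'n^'g" where
    "D z = (\<chi> k i j. X $ k $ i $ j * (e z i j * (complex_of_real (x j) - complex_of_real (x i))))" for z
  have der: "((\<lambda>z. tuple_conj (S z) X $ k $ i $ j) has_field_derivative D z $ k $ i $ j) (at z)"
    for z k i j
    unfolding conj_S D_def e_def by (auto intro!: derivative_eq_intros)
  have mem: "tuple_conj (S z) X \<in> \<Gamma>" for z
    using inv X invertible_diag_matrix[of "\<lambda>i. exp (z * of_real (x i))"]
    by (simp add: similarity_invariant_def S_def)
  have "\<beta> (tuple_conj (S z) X) $ k $ i $ j = \<beta> X $ k $ i $ j * e z i j" for k i j
  proof -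
    \<comment> \<open>This is an entry of \<beta> at the conjugated tuple, conjugated back by the
      inverse of \<open>S z\<close>: \<open>e z j i\<close> is the reciprocal of
      \<open>e z i j\<close>.\<close>
    define f where "f z = \<beta> (tuple_conj (S z) X) $ k $ i $ j * e z j i" for z
    have S0: "tuple_conj (S 0) X = X"
      by (simp add: vec_eq_iff conj_S e_def)
    have e_cancel: "e z i j * e z j i = 1" for z
      by (simp add: e_def right_diff_distrib exp_diff)
    have "f holomorphic_on UNIV"
      unfolding f_def e_def
      by (intro holomorphic_on_mult holomorphic_on_tuple_compose[OF holo open_dom der mem])
        (intro holomorphic_intros)
    moreover have "f (\<i> * of_real t) = f 0" for t
    proof -
      \<comment> \<open>As \<open>x\<close> is real, the exponents are purely imaginary here and the
        diagonal entries have modulus 1.\<close>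
      have "unitary_matrix (S (\<i> * of_real t))"
        unfolding S_def by (rule unitary_diag_matrix) (simp add: norm_exp_eq_Re)
      then have "\<beta> (tuple_conj (S (\<i> * of_real t)) X) = tuple_conj (S (\<i> * of_real t)) (\<beta> X)"
        using unitary X by (auto simp: respects_conj_def)
      then show ?thesis
        by (simp add: f_def conj_S S0 mult.assoc e_cancel) (simp add: e_def)
    qed
    ultimately have "f z = f 0"
      by (rule holomorphic_constant_if_constant_on_imaginary)
    then have "f z * e z i j = \<beta> X $ k $ i $ j * e z i j"
      by (simp add: f_def S0) (simp add: e_def)
    moreover have "f z * e z i j = \<beta> (tuple_conj (S z) X) $ k $ i $ j"
      by (simp add: f_def mult.assoc mult.commute[of "e z j i"] e_cancel)
    ultimately show ?thesis by simp
  qed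
  then have "\<beta> (tuple_conj (S z) X) = tuple_conj (S z) (\<beta> X)"
    by (simp add: vec_eq_iff conj_S)
  then show "\<beta> (tuple_conj (diag_matrix (\<lambda>i. exp (z * of_real (x i)))) X) =
      tuple_conj (diag_matrix (\<lambda>i. exp (z * of_real (x i)))) (\<beta> X)"
    by (simp add: S_def)
qed

text \<open>The polar form of each entry splits the matrix into a unitary diagonal factor and a
  positive one, the latter being the exponential family at \<open>z = 1\<close>.\<close>

lemma respects_conj_diag_matrix:
  assumes "\<And>i. d i \<noteq> 0"
  shows "respects_conj \<beta> \<Gamma> (diag_matrix d)"
proof -
  define x where "x i = ln (norm (d i))" for i
  define u where "u i = sgn (d i)" for i
  have "u i * exp (1 * of_real (x i)) = d i" for i
  proof -
    have "exp (1 * of_real (x i)) = complex_of_real (norm (d i))"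
      using assms[of i] unfolding x_def by (simp add: exp_of_real)
    then show ?thesis
      using assms[of i] unfolding u_def sgn_eq by simp
  qed
  then have "diag_matrix u ** diag_matrix (\<lambda>i. exp (1 * of_real (x i))) = diag_matrix d"
    by (simp only: diag_matrix_mul)
  moreover
  have U: "unitary_matrix (diag_matrix u)"
    using assms by (intro unitary_diag_matrix) (simp add: u_def norm_sgn)
  have "respects_conj \<beta> \<Gamma> (diag_matrix u ** diag_matrix (\<lambda>i. exp (1 * of_real (x i))))"
    by (rule respects_conj_matrix_mul[OF inv unitary_matrix_invertible[OF U]
          invertible_diag_matrix[OF exp_not_eq_zero] unitary[OF U] respects_conj_exp_diag])
  ultimately show ?thesis by simp
qed

lemma respects_conj_transvection:
  assumes pq: "p \<noteq> q"
  shows "respects_conj \<beta> \<Gamma> (block_matrix p q 1 c 0 1)"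
\<comment> \<open>The rescaling used for nonzero \<open>c\<close> divides by \<open>c\<close>; for
  \<open>c = 0\<close> the matrix is the identity.\<close>
proof (cases "c = 0")
  case True
  then show ?thesis
    using pq respects_conj_diag_matrix[of "\<lambda>_. 1"]
    by (simp add: block_matrix_one diag_matrix_one)
next
  case False
  \<comment> \<open>The factor \<open>r\<close> normalizes the vectors (2, 1) and (1, -2), which
    give the two rotations. The entry 3/2 = 2 - 1/2 is chosen to make the singular values
    rational.\<close>
  define r :: real where "r = 1 / sqrt 5"
  have r: "r * r = 1 / 5" "complex_of_real r * complex_of_real r = 1 / 5"
    by (simp_all add: r_def flip: of_real_mult)
  define V :: "complex^'n^'n" where
    "V = block_matrix p q (of_real (2 * r)) (of_real (- r)) (of_real r) (of_real (2 * r))"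
  \<comment> \<open>The double negation matches the shape of \<open>unitary_rotation\<close> with
    \<open>b = - 2 * r\<close>.\<close>
  define W :: "complex^'n^'n" where
    "W = block_matrix p q (of_real r) (of_real (- (- 2 * r))) (of_real (- 2 * r)) (of_real r)"
  have "unitary_matrix V" "unitary_matrix W"
    unfolding V_def W_def using pq r
    by (intro unitary_rotation; simp add: power2_eq_square)+
  then have VW: "respects_conj \<beta> \<Gamma> V" "invertible V" "respects_conj \<beta> \<Gamma> W" "invertible W"
    using unitary unitary_matrix_invertible by auto
  have diag: "respects_conj \<beta> \<Gamma> (block_matrix p q a 0 0 d)" "invertible (block_matrix p q a 0 0 d)"
    if "a \<noteq> 0" "d \<noteq> 0" for a d :: complex
    using that pq by (auto simp: block_matrix_diagonal
        intro!: respects_conj_diag_matrix invertible_diag_matrix split: if_splits)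
  \<comment> \<open>The singular value decomposition of \<open>1 3/2; 0 1\<close>, with singular values 2 and 1/2; the outer
    factors rescale the entry 3/2 to \<open>c\<close>.\<close>
  have "block_matrix p q 1 c 0 1 = block_matrix p q (2 * c / 3) 0 0 1 ** V ** block_matrix p q 2 0 0 (1/2)
      ** W ** block_matrix p q (3 / (2 * c)) 0 0 1"
    using pq r False by (simp add: V_def W_def block_matrix_mul field_simps)
  also have "respects_conj \<beta> \<Gamma> \<dots>"
    by (intro respects_conj_matrix_mul inv VW diag invertible_mult) (use False in auto)
  finally show ?thesis .
qed

lemma respects_conj_invertible: "invertible S \<Longrightarrow> respects_conj \<beta> \<Gamma> S"
proof (induction S rule: invertible_matrix_induct)
  case (mult A B)
  then show ?case
    using inv by (intro respects_conj_matrix_mul)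
next
  case (diagonal d)
  then show ?case
    by (rule respects_conj_diag_matrix)
next
  case (transvection p q c)
  then show ?case
    by (rule respects_conj_transvection)
qed

end

theorem proposition3p5:
  fixes \<Gamma> :: "(complex^'n^'n^'g) set"
    and \<beta> :: "complex^'n^'n^'g \<Rightarrow> complex^'n^'n^'h"
  assumes "\<Gamma> \<noteq> {}"
    and "open \<Gamma>"
    and "similarity_invariant \<Gamma>"
    and "tuple_holomorphic_on \<beta> \<Gamma>"
    and "\<And>X U. X \<in> \<Gamma> \<Longrightarrow> unitary_matrix U \<Longrightarrow>
           \<beta> (tuple_conj U X) = tuple_conj U (\<beta> X)"
  shows "\<forall>X\<in>\<Gamma>. \<forall>S. invertible S \<longrightarrow> \<beta> (tuple_conj S X) = tuple_conj S (\<beta> X)"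
  using respects_conj_invertible[OF assms(2-4)] assms(5) unfolding respects_conj_def by blast

end
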